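(* Let $U(t,x)=[\rho,u,E,B]$, $t\ge0$, $x\in\mathbb{R}^3$, be a well-defined solution to the Cauchy problem for the linear system $$\begin{cases}\partial_t\rho+\nabla\cdot u=0,\\ \partial_t u+\gamma\nabla\rho+E+u=0,\\ \partial_t E-\nabla\times B-u=0,\\ \partial_t B+\nabla\times E=0,\\ \nabla\cdot E=-\rho,\quad\nabla\cdot B=0,\end{cases}\qquad t>0,\ x\in\mathbb{R}^3,$$ with initial data $U|_{t=0}=U_0=[\rho_0,u_0,E_0,B_0]$ satisfying $\nabla\cdot E_0=-\rho_0$, $\nabla\cdot B_0=0$. Then there are $\lambda>0$, $C>0$ such that $$|\hat U(t,k)|\le Ce^{-\frac{\lambda|k|^2t}{(1+|k|^2)^2}}|\hat U_0(k)|$$ holds for any $t\ge0$ and $k\in\mathbb{R}^3$.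
   Context: $\gamma>1$ is a fixed constant; $\rho$ is scalar and $u,E,B$ are $\mathbb{R}^3$-valued. The Fourier transform in $x$ is $\hat f(k)=\int_{\mathbb{R}^3}e^{-ix\cdot k}f(x)\,dx$, and $|\hat U|^2=|\hat\rho|^2+|\hat u|^2+|\hat E|^2+|\hat B|^2$. "Well-defined" means that the Fourier transform in $x$ makes sense and satisfies the Fourier-transformed system. The constants $\lambda,C$ are generic, i.e. independent of $t$, $k$ and $U_0$. *)

theory Defs
  imports "HOL-Analysis.Analysis"
begin

record em_state =
  dens :: "real^3 \<Rightarrow> real"
  vel  :: "real^3 \<Rightarrow> real^3"
  elec :: "real^3 \<Rightarrow> real^3"
  mag  :: "real^3 \<Rightarrow> real^3"


section \<open>Distributional derivatives in space\<close>

definition partial :: "3 \<Rightarrow> (real^3 \<Rightarrow> real) \<Rightarrow> real^3 \<Rightarrow> real" where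
  "partial j \<phi> x = frechet_derivative \<phi> (at x) (axis j 1)"

primrec Ck :: "nat \<Rightarrow> (real^3 \<Rightarrow> real) \<Rightarrow> bool" where
  "Ck 0 \<phi> \<longleftrightarrow> continuous_on UNIV \<phi>"
| "Ck (Suc n) \<phi> \<longleftrightarrow> (\<forall>x. \<phi> differentiable (at x)) \<and> (\<forall>j. Ck n (partial j \<phi>))"

definition test_function :: "(real^3 \<Rightarrow> real) \<Rightarrow> bool" where
  "test_function \<phi> \<longleftrightarrow> (\<forall>n. Ck n \<phi>) \<and> compact (closure {x. \<phi> x \<noteq> 0})"

definition pairing :: "(real^3 \<Rightarrow> real) \<Rightarrow> (real^3 \<Rightarrow> real) \<Rightarrow> real" where
  "pairing f \<phi> = (LINT x|lborel. f x * \<phi> x)"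

definition vpairing :: "(real^3 \<Rightarrow> real^3) \<Rightarrow> (real^3 \<Rightarrow> real) \<Rightarrow> real^3" where
  "vpairing v \<phi> = (\<chi> j. pairing (\<lambda>x. v x $ j) \<phi>)"

definition dpartial :: "3 \<Rightarrow> (real^3 \<Rightarrow> real) \<Rightarrow> (real^3 \<Rightarrow> real) \<Rightarrow> real" where
  "dpartial j f \<phi> = - pairing f (partial j \<phi>)"

definition dgrad :: "(real^3 \<Rightarrow> real) \<Rightarrow> (real^3 \<Rightarrow> real) \<Rightarrow> real^3" where
  "dgrad f \<phi> = (\<chi> j. dpartial j f \<phi>)"

definition ddiv :: "(real^3 \<Rightarrow> real^3) \<Rightarrow> (real^3 \<Rightarrow> real) \<Rightarrow> real" where
  "ddiv v \<phi> = (\<Sum>j\<in>UNIV. dpartial j (\<lambda>x. v x $ j) \<phi>)"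

definition dcurl :: "(real^3 \<Rightarrow> real^3) \<Rightarrow> (real^3 \<Rightarrow> real) \<Rightarrow> real^3" where
  "dcurl v \<phi> = vector
     [dpartial 2 (\<lambda>x. v x $ 3) \<phi> - dpartial 3 (\<lambda>x. v x $ 2) \<phi>,
      dpartial 3 (\<lambda>x. v x $ 1) \<phi> - dpartial 1 (\<lambda>x. v x $ 3) \<phi>,
      dpartial 1 (\<lambda>x. v x $ 2) \<phi> - dpartial 2 (\<lambda>x. v x $ 1) \<phi>]"


section \<open>The Fourier transform in space\<close>

definition fourier :: "(real^3 \<Rightarrow> real) \<Rightarrow> real^3 \<Rightarrow> complex" where
  "fourier f k = (LINT x|lborel. exp (- \<i> * of_real (x \<bullet> k)) * of_real (f x))"

definition vfourier :: "(real^3 \<Rightarrow> real^3) \<Rightarrow> real^3 \<Rightarrow> complex^3" where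
  "vfourier v k = (\<chi> j. fourier (\<lambda>x. v x $ j) k)"

definition fourier_norm :: "em_state \<Rightarrow> real^3 \<Rightarrow> real" where
  "fourier_norm S k = sqrt ((norm (fourier (dens S) k))\<^sup>2 + (norm (vfourier (vel S) k))\<^sup>2
     + (norm (vfourier (elec S) k))\<^sup>2 + (norm (vfourier (mag S) k))\<^sup>2)"

definition integrable_state :: "em_state \<Rightarrow> bool" where
  "integrable_state S \<longleftrightarrow> integrable lborel (dens S) \<and> integrable lborel (vel S)
     \<and> integrable lborel (elec S) \<and> integrable lborel (mag S)"

text \<open>The products of a real vector \<open>k\<close> with a complex vector \<open>w\<close>; both are bilinear
  (no conjugation), so the symbols of div and curl are \<open>\<i>\<close> times these products.\<close>

definition cdot :: "real^3 \<Rightarrow> complex^3 \<Rightarrow> complex" where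
  "cdot k w = (\<Sum>j\<in>UNIV. of_real (k $ j) * w $ j)"

definition ccross :: "real^3 \<Rightarrow> complex^3 \<Rightarrow> complex^3" where
  "ccross k w = vector
     [of_real (k $ 2) * w $ 3 - of_real (k $ 3) * w $ 2,
      of_real (k $ 3) * w $ 1 - of_real (k $ 1) * w $ 3,
      of_real (k $ 1) * w $ 2 - of_real (k $ 2) * w $ 1]"


section \<open>The Cauchy problem\<close>

definition compatible_data :: "em_state \<Rightarrow> bool" where
  "compatible_data S \<longleftrightarrow> (\<forall>\<phi>. test_function \<phi> \<longrightarrow>
     ddiv (elec S) \<phi> = - pairing (dens S) \<phi> \<and> ddiv (mag S) \<phi> = 0)"

text \<open>The system is understood in the sense of distributions in \<open>x\<close>, pointwise in \<open>t > 0\<close>,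
  with the initial data attained in the same sense. This covers \<open>C\<^sup>1\<close> solutions continuous up to \<open>t = 0\<close>, as well as
  the less regular solutions given by the semigroup.\<close>

definition solves_system :: "real \<Rightarrow> (real \<Rightarrow> em_state) \<Rightarrow> bool" where
  "solves_system \<gamma> U \<longleftrightarrow> (\<forall>\<phi>. test_function \<phi> \<longrightarrow> (\<forall>t>0.
     ((\<lambda>s. pairing (dens (U s)) \<phi>) has_vector_derivative
        - ddiv (vel (U t)) \<phi>) (at t) \<and>
     ((\<lambda>s. vpairing (vel (U s)) \<phi>) has_vector_derivative
        - (\<gamma> *\<^sub>R dgrad (dens (U t)) \<phi>) - vpairing (elec (U t)) \<phi> - vpairing (vel (U t)) \<phi>) (at t) \<and>
     ((\<lambda>s. vpairing (elec (U s)) \<phi>) has_vector_derivative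
        dcurl (mag (U t)) \<phi> + vpairing (vel (U t)) \<phi>) (at t) \<and>
     ((\<lambda>s. vpairing (mag (U s)) \<phi>) has_vector_derivative
        - dcurl (elec (U t)) \<phi>) (at t) \<and>
     ddiv (elec (U t)) \<phi> = - pairing (dens (U t)) \<phi> \<and>
     ddiv (mag (U t)) \<phi> = 0))"

definition attains_data :: "(real \<Rightarrow> em_state) \<Rightarrow> em_state \<Rightarrow> bool" where
  "attains_data U U0 \<longleftrightarrow> U 0 = U0 \<and> (\<forall>\<phi>. test_function \<phi> \<longrightarrow>
     ((\<lambda>t. pairing (dens (U t)) \<phi>) \<longlongrightarrow> pairing (dens U0) \<phi>) (at_right 0) \<and>
     ((\<lambda>t. vpairing (vel (U t)) \<phi>) \<longlongrightarrow> vpairing (vel U0) \<phi>) (at_right 0) \<and>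
     ((\<lambda>t. vpairing (elec (U t)) \<phi>) \<longlongrightarrow> vpairing (elec U0) \<phi>) (at_right 0) \<and>
     ((\<lambda>t. vpairing (mag (U t)) \<phi>) \<longlongrightarrow> vpairing (mag U0) \<phi>) (at_right 0))"

definition solves_fourier_system :: "real \<Rightarrow> (real \<Rightarrow> em_state) \<Rightarrow> bool" where
  "solves_fourier_system \<gamma> U \<longleftrightarrow> (\<forall>k. \<forall>t>0.
     ((\<lambda>s. fourier (dens (U s)) k) has_vector_derivative
        - (\<i> * cdot k (vfourier (vel (U t)) k))) (at t) \<and>
     ((\<lambda>s. vfourier (vel (U s)) k) has_vector_derivative
        - (\<chi> j. of_real \<gamma> * \<i> * of_real (k $ j) * fourier (dens (U t)) k)
        - vfourier (elec (U t)) k - vfourier (vel (U t)) k) (at t) \<and>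
     ((\<lambda>s. vfourier (elec (U s)) k) has_vector_derivative
        \<i> *s ccross k (vfourier (mag (U t)) k) + vfourier (vel (U t)) k) (at t) \<and>
     ((\<lambda>s. vfourier (mag (U s)) k) has_vector_derivative
        - (\<i> *s ccross k (vfourier (elec (U t)) k))) (at t) \<and>
     \<i> * cdot k (vfourier (elec (U t)) k) = - fourier (dens (U t)) k \<and>
     \<i> * cdot k (vfourier (mag (U t)) k) = 0)"

definition attains_fourier_data :: "(real \<Rightarrow> em_state) \<Rightarrow> em_state \<Rightarrow> bool" where
  "attains_fourier_data U U0 \<longleftrightarrow> (\<forall>k.
     ((\<lambda>t. fourier (dens (U t)) k) \<longlongrightarrow> fourier (dens U0) k) (at_right 0) \<and>
     ((\<lambda>t. vfourier (vel (U t)) k) \<longlongrightarrow> vfourier (vel U0) k) (at_right 0) \<and>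
     ((\<lambda>t. vfourier (elec (U t)) k) \<longlongrightarrow> vfourier (elec U0) k) (at_right 0) \<and>
     ((\<lambda>t. vfourier (mag (U t)) k) \<longlongrightarrow> vfourier (mag U0) k) (at_right 0))"

definition cauchy_solution :: "real \<Rightarrow> (real \<Rightarrow> em_state) \<Rightarrow> em_state \<Rightarrow> bool" where
  "cauchy_solution \<gamma> U U0 \<longleftrightarrow> solves_system \<gamma> U \<and> attains_data U U0"

text \<open>The Fourier transform is the Lebesgue integral, so it makes sense at every frequency
  precisely for integrable fields.\<close>

definition well_defined :: "real \<Rightarrow> (real \<Rightarrow> em_state) \<Rightarrow> em_state \<Rightarrow> bool" where
  "well_defined \<gamma> U U0 \<longleftrightarrow> (\<forall>t\<ge>0. integrable_state (U t)) \<and>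
     solves_fourier_system \<gamma> U \<and> attains_fourier_data U U0"

end

theory Submission
  imports Defs
begin

text \<open>At a fixed frequency \<open>k\<close> the Fourier-transformed system is an ODE with energy
  \<open>W = \<gamma>|\<rho>|\<^sup>2 + |u|\<^sup>2 + |E|\<^sup>2 + |B|\<^sup>2\<close> (hats omitted) that dissipates only \<open>u\<close>:
  \<open>W' = - 2|u|\<^sup>2\<close>. With the real inner product on \<open>\<complex>\<^sup>3\<close>, the constraint \<open>i k \<cdot> E = - \<rho>\<close> gives
  \<open>\<langle>u, E\<rangle>' = - \<gamma>|\<rho>|\<^sup>2 - |E|\<^sup>2 + ...\<close>, and \<open>k \<cdot> B = 0\<close> gives
  \<open>- \<langle>E, i k \<times> B\<rangle>' = - |k|\<^sup>2|B|\<^sup>2 + |k \<times> E|\<^sup>2 - ...\<close>. Adding these two terms with small weights of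
  order \<open>(1 + |k|\<^sup>2)\<^sup>-\<^sup>1\<close> and \<open>(1 + |k|\<^sup>2)\<^sup>-\<^sup>2\<close> turns \<open>W\<close> into an equivalent functional that decays
  at a rate proportional to \<open>|k|\<^sup>2 / (1 + |k|\<^sup>2)\<^sup>2\<close>.\<close>

section \<open>Symbols of curl and gradient at a fixed frequency\<close>

definition curl_symbol :: "real^3 \<Rightarrow> complex^3 \<Rightarrow> complex^3" where
  "curl_symbol k w = \<i> *s ccross k w"

definition grad_symbol :: "real^3 \<Rightarrow> complex \<Rightarrow> complex^3" where
  "grad_symbol k z = (\<chi> j. \<i> * of_real (k $ j) * z)"

lemma inner_vec_complex3:
  fixes x y :: "complex^3"
  shows "x \<bullet> y = Re (x$1) * Re (y$1) + Im (x$1) * Im (y$1)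
    + (Re (x$2) * Re (y$2) + Im (x$2) * Im (y$2))
    + (Re (x$3) * Re (y$3) + Im (x$3) * Im (y$3))"
  by (simp add: inner_vec_def sum_3 inner_complex_def)

lemma curl_symbol_components:
  "curl_symbol k w $ 1 = \<i> * (of_real (k $ 2) * w $ 3 - of_real (k $ 3) * w $ 2)"
  "curl_symbol k w $ 2 = \<i> * (of_real (k $ 3) * w $ 1 - of_real (k $ 1) * w $ 3)"
  "curl_symbol k w $ 3 = \<i> * (of_real (k $ 1) * w $ 2 - of_real (k $ 2) * w $ 1)"
  by (simp_all add: curl_symbol_def ccross_def)

lemma bounded_linear_curl_symbol: "bounded_linear (curl_symbol k)"
  unfolding linear_conv_bounded_linear[symmetric]
  by (rule linearI) (simp_all add: vec_eq_iff forall_3 curl_symbol_components algebra_simps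
      scaleR_conv_of_real[where 'a = complex])

text \<open>The cross product with \<open>k\<close> is skew, and so is multiplication by \<i> for
  the real inner product; the two signs cancel. This is what removes the coupling of E and B from
  the energy balance.\<close>

lemma curl_symbol_selfadjoint: "x \<bullet> curl_symbol k y = curl_symbol k x \<bullet> y"
  by (simp add: inner_vec_complex3 curl_symbol_components algebra_simps)

text \<open>Lagrange's identity for the cross product; as \<open>k\<close> is real, the real and
  imaginary parts of \<open>w\<close> contribute separately. It bounds the curl symbol by
  \<open>norm k\<close> and turns the bound into an equality on divergence-free fields.\<close>

lemma curl_symbol_lagrange:
  "(norm (curl_symbol k w))\<^sup>2 + (norm (cdot k w))\<^sup>2 = (norm k)\<^sup>2 * (norm w)\<^sup>2"
  unfolding power2_norm_eq_inner
  by (simp add: inner_vec_complex3 inner_complex_def inner_vec_def[of k] curl_symbol_components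
      cdot_def sum_3) algebra

lemma norm_curl_symbol_le: "norm (curl_symbol k w) \<le> norm k * norm w"
proof (rule power2_le_imp_le)
  show "(norm (curl_symbol k w))\<^sup>2 \<le> (norm k * norm w)\<^sup>2"
    using curl_symbol_lagrange[of k w] zero_le_power2[of "norm (cdot k w)"]
    by (simp only: power_mult_distrib)
qed simp

lemma norm_curl_symbol_eq:
  assumes "cdot k w = 0"
  shows "norm (curl_symbol k w) = norm k * norm w"
  by (rule power2_eq_imp_eq) (use curl_symbol_lagrange[of k w] assms in \<open>simp_all add: power_mult_distrib\<close>)

text \<open>Integration by parts on the Fourier side: gradient and divergence are negative adjoints
  of each other.\<close>

lemma inner_grad_symbol: "x \<bullet> grad_symbol k z = - ((\<i> * cdot k x) \<bullet> z)"
  by (simp add: inner_vec_complex3 inner_complex_def grad_symbol_def cdot_def sum_3 algebra_simps)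

section \<open>Energy and Lyapunov functional\<close>

definition energy :: "real \<Rightarrow> complex \<Rightarrow> complex^3 \<Rightarrow> complex^3 \<Rightarrow> complex^3 \<Rightarrow> real" where
  "energy \<gamma> p u e b = \<gamma> * (p \<bullet> p) + u \<bullet> u + e \<bullet> e + b \<bullet> b"

text \<open>The second weight needs the extra factor \<open>1 / (1 + (norm k)\<^sup>2)\<close>: its
  cross term produces |k x E|^2, which can be as large as |k|^2 |E|^2 and must stay below the gain
  in |E|^2 from the first cross term.\<close>

definition lyapunov ::
    "real \<Rightarrow> real^3 \<Rightarrow> complex \<Rightarrow> complex^3 \<Rightarrow> complex^3 \<Rightarrow> complex^3 \<Rightarrow> real" where
  "lyapunov \<gamma> k p u e b = energy \<gamma> p u e b + 1 / (8 * (1 + (norm k)\<^sup>2)) * (u \<bullet> e)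
     - 1 / (32 * (1 + (norm k)\<^sup>2)\<^sup>2) * (e \<bullet> curl_symbol k b)"

lemma mult_le_half_squares:
  fixes x y :: real
  shows "x * y \<le> (x\<^sup>2 + y\<^sup>2) / 2"
  using zero_le_power2[of "x - y"] by (simp add: power2_diff)

text \<open>By Cauchy-Schwarz and \<open>norm k \<le> 1 + (norm k)\<^sup>2\<close>, the weighted
  cross terms are at most (|u|^2 + |E|^2)/16 and (|E|^2 + |B|^2)/64, together well below half the
  energy.\<close>

lemma lyapunov_equivalent_energy:
  assumes "\<gamma> \<ge> 0"
  shows "energy \<gamma> p u e b / 2 \<le> lyapunov \<gamma> k p u e b"
    and "lyapunov \<gamma> k p u e b \<le> 2 * energy \<gamma> p u e b"
proof -
  define q m where "q = norm k" and "m = 1 + q\<^sup>2"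
  have m: "m \<ge> 1" and qm: "q \<le> m" "q \<ge> 0"
    using zero_le_power2[of "q - 1"] norm_ge_zero[of k]
    by (simp_all add: m_def power2_diff flip: q_def)
  have "\<bar>u \<bullet> e\<bar> \<le> norm u * norm e"
    by (rule Cauchy_Schwarz_ineq2)
  also have "\<dots> \<le> (u \<bullet> u + e \<bullet> e) / 2"
    using mult_le_half_squares by (simp add: power2_norm_eq_inner[symmetric])
  finally have ue: "\<bar>u \<bullet> e\<bar> \<le> (u \<bullet> u + e \<bullet> e) / 2" .
  have m_div: "\<bar>x / m\<bar> \<le> \<bar>x\<bar>" for x
    using m by (simp add: abs_div divide_le_eq mult_left_le mult_le_cancel_left1)
  have "\<bar>e \<bullet> curl_symbol k b\<bar> \<le> norm e * norm (curl_symbol k b)"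
    by (rule Cauchy_Schwarz_ineq2)
  also have "\<dots> \<le> norm e * (m * norm b)"
    using norm_curl_symbol_le[of k b] mult_right_mono[OF qm(1), of "norm b"]
    by (intro mult_left_mono) (auto simp: q_def)
  finally have "\<bar>(e \<bullet> curl_symbol k b) / m\<bar> \<le> norm e * norm b"
    using m by (simp add: abs_div divide_le_eq mult_ac)
  also have "\<dots> \<le> (e \<bullet> e + b \<bullet> b) / 2"
    using mult_le_half_squares by (simp add: power2_norm_eq_inner[symmetric])
  finally have eb: "\<bar>(e \<bullet> curl_symbol k b) / m / m\<bar> \<le> (e \<bullet> e + b \<bullet> b) / 2"
    using m_div order_trans by blast
  have eq: "lyapunov \<gamma> k p u e b
      = energy \<gamma> p u e b + (u \<bullet> e) / m / 8 - (e \<bullet> curl_symbol k b) / m / m / 32"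
    unfolding lyapunov_def by (simp add: power2_eq_square[of m] mult.commute flip: q_def m_def)
  have "\<gamma> * (p \<bullet> p) \<ge> 0" "u \<bullet> u \<ge> 0" "e \<bullet> e \<ge> 0" "b \<bullet> b \<ge> 0"
    using assms by simp_all
  then show "energy \<gamma> p u e b / 2 \<le> lyapunov \<gamma> k p u e b"
    and "lyapunov \<gamma> k p u e b \<le> 2 * energy \<gamma> p u e b"
    using ue eb m_div[of "u \<bullet> e"] unfolding eq energy_def by argo+
qed

text \<open>Here \<open>x, y, z\<close> stand for \<open>|u|, |E|, |B|\<close>, \<open>g\<close> for \<open>\<gamma>|\<rho>|\<^sup>2\<close>, and \<open>ue, ub, ce\<close> for
  \<open>\<langle>u, E\<rangle>, \<langle>u, i k \<times> B\<rangle>, |k \<times> E|\<^sup>2\<close>.\<close>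

lemma dissipation_inequality:
  fixes q m g x y z ub ue ce :: real
  assumes m: "m = 1 + q\<^sup>2" and q: "q \<ge> 0" and g: "g \<ge> 0"
    and ub: "ub \<le> q * x * z" "- ub \<le> q * x * z" and ue: "- ue \<le> x * y" and ce: "ce \<le> q\<^sup>2 * y\<^sup>2"
  shows "- (2 * x\<^sup>2) + 1 / (8 * m) * (- g - y\<^sup>2 - ue + ub + x\<^sup>2)
      - 1 / (32 * m\<^sup>2) * (q\<^sup>2 * z\<^sup>2 + ub - ce)
    \<le> - (1 / 64) * (q\<^sup>2 / m\<^sup>2) * (g + x\<^sup>2 + y\<^sup>2 + z\<^sup>2)"
proof -
  \<comment> \<open>The gains in \<open>g\<close> and \<open>y\<close> carry the factor
    \<open>w\<close>, the gain in \<open>z\<close> only \<open>v\<^sup>2\<close>. Since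
    \<open>v\<^sup>2 \<le> w\<close>, the latter dictates the rate
    \<open>q\<^sup>2 / m\<^sup>2\<close>.\<close>
  define w where "w = 1 / m"
  define v where "v = w * q"
  have m1: "m \<ge> 1" using m by simp
  have w: "0 \<le> w" "w \<le> 1" using m1 by (auto simp: w_def)
  have v2: "v\<^sup>2 \<le> w"
  proof -
    have "v\<^sup>2 = q\<^sup>2 / m * w" by (simp add: v_def w_def power2_eq_square)
    also have "\<dots> \<le> 1 * w" using m1 m w by (intro mult_right_mono) (auto simp: divide_le_eq not_less)
    finally show ?thesis by simp
  qed
  have w2: "w\<^sup>2 \<le> w" using w by (simp add: power2_eq_square mult_left_le)
  \<comment> \<open>The Young weights in \<open>A\<close> and \<open>B\<close> are chosen so that,
    after the factors 1/8 and 1/32, each costs \<open>(v * z)\<^sup>2 / 128\<close>. Half of the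
    gain \<open>(v * z)\<^sup>2 / 32\<close> then remains, which is the 1/64 of the
    conclusion.\<close>
  have "w * ub \<le> w * (q * x * z)" using ub(1) w by (intro mult_left_mono)
  then have A: "w * ub \<le> 4 * x\<^sup>2 + (v * z)\<^sup>2 / 16"
    using zero_le_power2[of "2 * x - v * z / 4"] by (simp add: v_def power2_diff power_divide mult_ac)
  have "w\<^sup>2 * - ub \<le> w\<^sup>2 * (q * x * z)" using ub(2) by (intro mult_left_mono) auto
  also have "\<dots> = (w * x) * (v * z)" by (simp add: v_def power2_eq_square)
  also have "\<dots> \<le> (w * x)\<^sup>2 + (v * z)\<^sup>2 / 4"
    using zero_le_power2[of "w * x - v * z / 2"] by (simp add: power2_diff power_divide)
  also have "(w * x)\<^sup>2 \<le> x\<^sup>2"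
    using w mult_right_mono[of "w\<^sup>2" 1 "x\<^sup>2"] by (simp add: power_mult_distrib power_le_one)
  finally have B: "- (w\<^sup>2 * ub) \<le> x\<^sup>2 + (v * z)\<^sup>2 / 4" by simp
  have "- ue \<le> x\<^sup>2 + y\<^sup>2 / 4"
    using ue zero_le_power2[of "x - y / 2"] by (simp add: power2_diff power_divide)
  then have "w * - ue \<le> w * (x\<^sup>2 + y\<^sup>2 / 4)" using w by (intro mult_left_mono)
  then have C: "- (w * ue) \<le> w * x\<^sup>2 + w * y\<^sup>2 / 4" by (simp add: algebra_simps)
  \<comment> \<open>Of the gain \<open>w * y\<^sup>2 / 8\<close>, the bound \<open>C\<close> takes a
    quarter; by \<open>v\<^sup>2 \<le> w\<close> this term takes at most another quarter.\<close>
  have "w\<^sup>2 * ce \<le> w\<^sup>2 * (q\<^sup>2 * y\<^sup>2)" using ce by (intro mult_left_mono) auto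
  also have "\<dots> = v\<^sup>2 * y\<^sup>2" by (simp add: v_def power_mult_distrib)
  finally have D: "w\<^sup>2 * ce \<le> v\<^sup>2 * y\<^sup>2" .
  have E: "v\<^sup>2 * y\<^sup>2 \<le> w * y\<^sup>2" "v\<^sup>2 * g \<le> w * g" "v\<^sup>2 * x\<^sup>2 \<le> w * x\<^sup>2" "w * x\<^sup>2 \<le> x\<^sup>2" "0 \<le> w * g"
    "0 \<le> w * y\<^sup>2" "0 \<le> w * x\<^sup>2"
    using v2 w g mult_right_mono[of w 1 "x\<^sup>2"] by (auto intro!: mult_right_mono)
  have "- (2 * x\<^sup>2) + 1 / (8 * m) * (- g - y\<^sup>2 - ue + ub + x\<^sup>2)
        - 1 / (32 * m\<^sup>2) * (q\<^sup>2 * z\<^sup>2 + ub - ce)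
      = - (2 * x\<^sup>2) + (- (w * g) - w * y\<^sup>2 - w * ue + w * ub + w * x\<^sup>2) / 8
        - ((v * z)\<^sup>2 + w\<^sup>2 * ub - w\<^sup>2 * ce) / 32"
    by (simp add: w_def v_def power_mult_distrib power_divide add_divide_distrib diff_divide_distrib)
  also have "\<dots> \<le> - (1 / 64) * (v\<^sup>2 * g + v\<^sup>2 * x\<^sup>2 + v\<^sup>2 * y\<^sup>2 + (v * z)\<^sup>2)"
    using A B C D E by argo
  also have "\<dots> = - (1 / 64) * (q\<^sup>2 / m\<^sup>2) * (g + x\<^sup>2 + y\<^sup>2 + z\<^sup>2)"
    by (simp add: v_def w_def power_mult_distrib power_divide algebra_simps add_divide_distrib)
  finally show ?thesis .
qed

section \<open>Time derivative of the Lyapunov functional along solutions\<close>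

lemma has_real_derivative_inner:
  fixes f g :: "real \<Rightarrow> 'a::real_inner"
  assumes "(f has_vector_derivative f') (at t)" "(g has_vector_derivative g') (at t)"
  shows "((\<lambda>s. f s \<bullet> g s) has_real_derivative f t \<bullet> g' + f' \<bullet> g t) (at t)"
  using bounded_bilinear.has_vector_derivative[OF bounded_bilinear_inner assms]
  by (simp add: has_real_derivative_iff_has_vector_derivative)

text \<open>In the energy part, the weight \<gamma> cancels gradient against divergence,
  self-adjointness cancels the two curls, and the couplings of u and E have opposite signs, so only
  the damping of u survives. The cross terms feed \<open>dissipation_inequality\<close>.\<close>

lemma lyapunov_derivative:
  fixes p :: "real \<Rightarrow> complex" and u e b :: "real \<Rightarrow> complex^3"
  assumes "\<gamma> \<ge> 0"
    and p: "(p has_vector_derivative - (\<i> * cdot k (u t))) (at t)"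
    and u: "(u has_vector_derivative - (\<gamma> *\<^sub>R grad_symbol k (p t)) - e t - u t) (at t)"
    and e: "(e has_vector_derivative curl_symbol k (b t) + u t) (at t)"
    and b: "(b has_vector_derivative - curl_symbol k (e t)) (at t)"
    and gauss: "\<i> * cdot k (e t) = - p t" and divfree: "cdot k (b t) = 0"
  shows "\<exists>D. ((\<lambda>s. lyapunov \<gamma> k (p s) (u s) (e s) (b s)) has_real_derivative D) (at t) \<and>
    D \<le> - (1 / 64) * ((norm k)\<^sup>2 / (1 + (norm k)\<^sup>2)\<^sup>2) * energy \<gamma> (p t) (u t) (e t) (b t)"
proof -
  define m where "m = 1 + (norm k)\<^sup>2"
  define K where "K = curl_symbol k"
  note lin = bounded_linear_curl_symbol[of k, folded K_def]
  have Kb: "((\<lambda>s. K (b s)) has_vector_derivative K (- K (e t))) (at t)"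
    using bounded_linear.has_vector_derivative[OF lin b[folded K_def]] .
  note e = e[folded K_def] and b = b[folded K_def]
  note has = has_real_derivative_inner
  let ?u' = "- (\<gamma> *\<^sub>R grad_symbol k (p t)) - e t - u t"
  let ?D = "\<gamma> * (p t \<bullet> - (\<i> * cdot k (u t)) + - (\<i> * cdot k (u t)) \<bullet> p t)
      + (u t \<bullet> ?u' + ?u' \<bullet> u t)
      + (e t \<bullet> (K (b t) + u t) + (K (b t) + u t) \<bullet> e t)
      + (b t \<bullet> - K (e t) + - K (e t) \<bullet> b t)
      + 1 / (8 * m) * (u t \<bullet> (K (b t) + u t) + ?u' \<bullet> e t)
      - 1 / (32 * m\<^sup>2) * (e t \<bullet> K (- K (e t)) + (K (b t) + u t) \<bullet> K (b t))"
  have deriv: "((\<lambda>s. lyapunov \<gamma> k (p s) (u s) (e s) (b s)) has_real_derivative ?D) (at t)"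
    unfolding lyapunov_def energy_def m_def[symmetric] K_def[symmetric]
    by (intro DERIV_add DERIV_diff DERIV_cmult has p u e b Kb)
  have adj: "K x \<bullet> y = x \<bullet> K y" for x y
    by (simp add: K_def curl_symbol_selfadjoint)
  have gu: "grad_symbol k (p t) \<bullet> u t = - ((\<i> * cdot k (u t)) \<bullet> p t)"
    by (subst inner_commute) (rule inner_grad_symbol)
  \<comment> \<open>Gauss's law turns the pressure term in the derivative of
    \<open>u \<bullet> e\<close> into dissipation of the density.\<close>
  have ge: "grad_symbol k (p t) \<bullet> e t = p t \<bullet> p t"
    by (subst inner_commute) (simp add: inner_grad_symbol gauss)
  have KK: "e t \<bullet> K (- K (e t)) = - (norm (K (e t)))\<^sup>2"
    by (simp add: adj[symmetric] power2_norm_eq_inner linear_neg[OF bounded_linear.linear[OF lin]])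
  have bK: "b t \<bullet> K (e t) = e t \<bullet> K (b t)"
    using adj[of "e t" "b t"] by (simp add: inner_commute)
  \<comment> \<open>As k . B = 0, the curl term controls all of B and not only its part transverse
    to \<open>k\<close>.\<close>
  have Kb2: "K (b t) \<bullet> K (b t) = (norm k)\<^sup>2 * (norm (b t))\<^sup>2"
    using norm_curl_symbol_eq[OF divfree]
    by (simp add: K_def power2_norm_eq_inner[symmetric] power_mult_distrib)
  have D: "?D = - (2 * (norm (u t))\<^sup>2)
      + 1 / (8 * m) * (- (\<gamma> * (p t \<bullet> p t)) - (norm (e t))\<^sup>2 - u t \<bullet> e t + u t \<bullet> K (b t) + (norm (u t))\<^sup>2)
      - 1 / (32 * m\<^sup>2) * ((norm k)\<^sup>2 * (norm (b t))\<^sup>2 + u t \<bullet> K (b t) - (norm (K (e t)))\<^sup>2)"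
  proof -
    let ?G = "grad_symbol k (p t)"
    have eqs: "p t \<bullet> - (\<i> * cdot k (u t)) + - (\<i> * cdot k (u t)) \<bullet> p t = 2 * (?G \<bullet> u t)"
      "u t \<bullet> ?u' + ?u' \<bullet> u t = - (2 * \<gamma> * (?G \<bullet> u t)) - 2 * (u t \<bullet> e t) - 2 * (norm (u t))\<^sup>2"
      "e t \<bullet> (K (b t) + u t) + (K (b t) + u t) \<bullet> e t = 2 * (e t \<bullet> K (b t)) + 2 * (u t \<bullet> e t)"
      "b t \<bullet> - K (e t) + - K (e t) \<bullet> b t = - (2 * (e t \<bullet> K (b t)))"
      "u t \<bullet> (K (b t) + u t) + ?u' \<bullet> e t
        = - (\<gamma> * (p t \<bullet> p t)) - (norm (e t))\<^sup>2 - u t \<bullet> e t + u t \<bullet> K (b t) + (norm (u t))\<^sup>2"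
      "e t \<bullet> K (- K (e t)) + (K (b t) + u t) \<bullet> K (b t)
        = (norm k)\<^sup>2 * (norm (b t))\<^sup>2 + u t \<bullet> K (b t) - (norm (K (e t)))\<^sup>2"
      by (simp_all add: inner_add_left inner_add_right inner_diff_left inner_diff_right gu ge KK bK
          Kb2 power2_norm_eq_inner inner_commute[of "p t" "\<i> * cdot k (u t)"]
          inner_commute[of "u t" ?G] inner_commute[of "e t" "u t"] inner_commute[of "K (b t)" "e t"]
          inner_commute[of "K (e t)" "b t"])
    show ?thesis
      unfolding eqs by (simp add: algebra_simps)
  qed
  have "\<bar>u t \<bullet> K (b t)\<bar> \<le> norm (u t) * norm (K (b t))" by (rule Cauchy_Schwarz_ineq2)
  also have "\<dots> = norm k * norm (u t) * norm (b t)"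
    by (simp add: K_def norm_curl_symbol_eq[OF divfree])
  finally have ub: "\<bar>u t \<bullet> K (b t)\<bar> \<le> norm k * norm (u t) * norm (b t)" .
  have ue: "\<bar>u t \<bullet> e t\<bar> \<le> norm (u t) * norm (e t)" by (rule Cauchy_Schwarz_ineq2)
  have ce: "(norm (K (e t)))\<^sup>2 \<le> (norm k)\<^sup>2 * (norm (e t))\<^sup>2"
    using power_mono[OF norm_curl_symbol_le[of k "e t"], of 2] by (simp add: K_def power_mult_distrib)
  have "?D \<le> - (1 / 64) * ((norm k)\<^sup>2 / m\<^sup>2)
      * (\<gamma> * (p t \<bullet> p t) + (norm (u t))\<^sup>2 + (norm (e t))\<^sup>2 + (norm (b t))\<^sup>2)"
    unfolding D using ub ue ce \<open>\<gamma> \<ge> 0\<close>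
    by (intro dissipation_inequality) (auto simp: m_def)
  then show ?thesis
    using deriv unfolding energy_def m_def power2_norm_eq_inner by blast
qed

section \<open>From the differential inequality to exponential decay\<close>

lemma gronwall_decay:
  fixes f :: "real \<Rightarrow> real"
  assumes cont: "(f \<longlongrightarrow> f 0) (at_right 0)"
    and deriv: "\<And>t. t > 0 \<Longrightarrow> \<exists>D. (f has_real_derivative D) (at t) \<and> D \<le> - c * f t"
    and "t \<ge> 0"
  shows "f t \<le> exp (- c * t) * f 0"
proof (cases "t = 0")
  case False
  with \<open>t \<ge> 0\<close> have "t > 0" by simp
  have isC: "isCont f s" if "s > 0" for s
    using deriv[OF that] DERIV_isCont by blast
  have "continuous (at s within {0..t}) f" if "s \<in> {0..t}" for s
  proof (cases "s = 0")
    case True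
    have "(f \<longlongrightarrow> f 0) (at 0 within {0..t})"
      using cont \<open>t > 0\<close> by (simp add: at_within_Icc_at_right)
    then show ?thesis using True by (simp add: continuous_within)
  next
    case False
    then show ?thesis using isC that by (simp add: continuous_at_imp_continuous_at_within)
  qed
  then have "continuous_on {0..t} f"
    by (simp add: continuous_on_eq_continuous_within)
  \<comment> \<open>The integrating factor makes \<open>exp (c * s) * f s\<close> nonincreasing on
    the open interval; continuity carries this to 0, where no derivative is assumed.\<close>
  then have "exp (c * t) * f t \<le> exp (c * 0) * f 0"
  proof (intro DERIV_nonpos_imp_decreasing_open[OF \<open>t \<ge> 0\<close>])
    fix s assume "0 < s" "s < t"
    then obtain D where D: "(f has_real_derivative D) (at s)" "D \<le> - c * f s"
      using deriv by blast
    have "((\<lambda>s. exp (c * s) * f s) has_real_derivative exp (c * s) * (c * f s + D)) (at s)"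
      by (auto intro!: derivative_eq_intros D(1) simp: algebra_simps)
    moreover have "exp (c * s) * (c * f s + D) \<le> 0"
      using D(2) by (intro mult_nonneg_nonpos) auto
    ultimately show "\<exists>y. ((\<lambda>s. exp (c * s) * f s) has_real_derivative y) (at s) \<and> y \<le> 0"
      by blast
  qed (auto intro!: continuous_intros)
  then show ?thesis
    by (simp add: exp_minus field_simps)
qed simp

lemma fourier_norm_power2:
  "(fourier_norm S k)\<^sup>2 = energy 1 (fourier (dens S) k) (vfourier (vel S) k)
     (vfourier (elec S) k) (vfourier (mag S) k)"
  by (simp add: fourier_norm_def energy_def power2_norm_eq_inner)

theorem corollary4p1:
  fixes \<gamma> :: real
  assumes "\<gamma> > 1"
  shows "\<exists>l>0. \<exists>C>0. \<forall>(U :: real \<Rightarrow> em_state) (U0 :: em_state).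
    compatible_data U0 \<longrightarrow> cauchy_solution \<gamma> U U0 \<longrightarrow> well_defined \<gamma> U U0 \<longrightarrow>
    (\<forall>t\<ge>0. \<forall>k :: real^3.
       fourier_norm (U t) k
         \<le> C * exp (- (l * (norm k)\<^sup>2 * t) / (1 + (norm k)\<^sup>2)\<^sup>2) * fourier_norm U0 k)"
proof -
  \<comment> \<open>The equivalence with the energy gives 2 * 2 and the bound of the energy by
    \<gamma> times the squared norm gives \<gamma>; the root of \<open>4 * \<gamma>\<close> is the
    constant. Taking the root also halves the rate 1/128 to 1/256.\<close>
  have main: "fourier_norm (U t) k
      \<le> 2 * sqrt \<gamma> * exp (- (1 / 256 * (norm k)\<^sup>2 * t) / (1 + (norm k)\<^sup>2)\<^sup>2) * fourier_norm U0 k"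
    if cauchy: "cauchy_solution \<gamma> U U0" and wd: "well_defined \<gamma> U U0" and t: "t \<ge> 0"
    for U U0 t and k :: "real^3"
  proof -
    define p u e b where "p = (\<lambda>s. fourier (dens (U s)) k)" and "u = (\<lambda>s. vfourier (vel (U s)) k)"
      and "e = (\<lambda>s. vfourier (elec (U s)) k)" and "b = (\<lambda>s. vfourier (mag (U s)) k)"
    define L where "L = (\<lambda>s. lyapunov \<gamma> k (p s) (u s) (e s) (b s))"
    define r where "r = (norm k)\<^sup>2 / (1 + (norm k)\<^sup>2)\<^sup>2"
    have U0: "U 0 = U0" using cauchy by (simp add: cauchy_solution_def attains_data_def)
    have grad: "(\<chi> j. of_real \<gamma> * \<i> * of_real (k $ j) * z) = \<gamma> *\<^sub>R grad_symbol k z" for z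
      by (simp add: vec_eq_iff grad_symbol_def scaleR_conv_of_real[where 'a=complex] mult_ac)
    have lim: "(p \<longlongrightarrow> p 0) (at_right 0)" "(u \<longlongrightarrow> u 0) (at_right 0)"
      "(e \<longlongrightarrow> e 0) (at_right 0)" "(b \<longlongrightarrow> b 0) (at_right 0)"
      using wd unfolding well_defined_def attains_fourier_data_def p_def u_def e_def b_def U0
      by blast+
    have fourier_system: "solves_fourier_system \<gamma> U"
      using wd by (simp add: well_defined_def)
    have "(L \<longlongrightarrow> L 0) (at_right 0)"
      unfolding L_def lyapunov_def energy_def
      by (intro tendsto_intros lim bounded_linear.tendsto[OF bounded_linear_curl_symbol])
    moreover have "\<exists>D. (L has_real_derivative D) (at s) \<and> D \<le> - (r / 128) * L s" if "s > 0" for s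
    proof -
      have sys: "(p has_vector_derivative - (\<i> * cdot k (u s))) (at s)"
        "(u has_vector_derivative - (\<gamma> *\<^sub>R grad_symbol k (p s)) - e s - u s) (at s)"
        "(e has_vector_derivative curl_symbol k (b s) + u s) (at s)"
        "(b has_vector_derivative - curl_symbol k (e s)) (at s)"
        "\<i> * cdot k (e s) = - p s" "\<i> * cdot k (b s) = 0"
        using fourier_system[unfolded solves_fourier_system_def, THEN spec[of _ k], rule_format, OF that]
        unfolding p_def u_def e_def b_def curl_symbol_def grad
        by simp_all
      obtain D where D: "(L has_real_derivative D) (at s)"
          "D \<le> - (1 / 64) * r * energy \<gamma> (p s) (u s) (e s) (b s)"
        using lyapunov_derivative[OF _ sys(1-5)] sys(6) assms
        unfolding L_def r_def by auto
      \<comment> \<open>Trading the energy for \<open>L\<close> in the dissipation costs a factor 2,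
        hence 1/128 instead of 1/64.\<close>
      have "r * L s \<le> r * (2 * energy \<gamma> (p s) (u s) (e s) (b s))"
        unfolding L_def using assms
        by (intro mult_left_mono lyapunov_equivalent_energy) (auto simp: r_def)
      with D show ?thesis by (intro exI[of _ D]) auto
    qed
    ultimately have decay: "L t \<le> exp (- (r / 128) * t) * L 0"
      using t by (rule gronwall_decay)
    have "(fourier_norm (U t) k)\<^sup>2 \<le> energy \<gamma> (p t) (u t) (e t) (b t)"
      using assms mult_right_mono[of 1 \<gamma> "p t \<bullet> p t"]
      by (simp add: fourier_norm_power2 energy_def p_def u_def e_def b_def)
    also have "\<dots> \<le> 2 * L t"
      using lyapunov_equivalent_energy(1)[of \<gamma> "p t" "u t" "e t" "b t" k] assms by (simp add: L_def)
    also have "\<dots> \<le> exp (- (r / 128) * t) * (2 * L 0)" using decay by simp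
    also have "\<dots> \<le> exp (- (r / 128) * t) * (4 * energy \<gamma> (p 0) (u 0) (e 0) (b 0))"
      using lyapunov_equivalent_energy(2)[of \<gamma> k "p 0" "u 0" "e 0" "b 0"] assms
      by (intro mult_left_mono) (auto simp: L_def)
    also have "\<dots> \<le> exp (- (r / 128) * t) * (4 * (\<gamma> * (fourier_norm U0 k)\<^sup>2))"
    proof -
      have "x \<le> \<gamma> * x" if "x \<ge> 0" for x
        using assms that mult_right_mono[of 1 \<gamma> x] by simp
      from this[of "u 0 \<bullet> u 0"] this[of "e 0 \<bullet> e 0"] this[of "b 0 \<bullet> b 0"] show ?thesis
        by (intro mult_left_mono)
          (auto simp: fourier_norm_power2 energy_def p_def u_def e_def b_def U0 algebra_simps)
    qed
    also have "\<dots> = (2 * sqrt \<gamma> * exp (- (1 / 256 * (norm k)\<^sup>2 * t) / (1 + (norm k)\<^sup>2)\<^sup>2)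
        * fourier_norm U0 k)\<^sup>2"
      using assms by (simp add: power_mult_distrib exp_double[symmetric] r_def mult_ac)
    finally show ?thesis
      by (rule power2_le_imp_le) (use assms in \<open>simp add: fourier_norm_def\<close>)
  qed
  show ?thesis
    by (intro exI[of _ "1/256"] exI[of _ "2 * sqrt \<gamma>"] conjI allI impI main) (use assms in auto)
qed

end
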